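(* Let $n,m\in\mathbb{N}$, let $\mathcal{H}\subseteq \mathbb{R}^n\times\mathbb{R}^{m\times n}\times\mathbb{R}^m$ with $(\hat c,\hat A,\hat b)\in\mathcal{H}$, let $\mathcal{D}(\hat x)\subseteq\mathbb{R}^n$, and let $\delta:\mathcal{H}\times\mathcal{H}\to\mathbb{R}_+$ be a given distance function. The problem $$(\mathrm{WCEP}):\quad \inf_{x,c,A,b}\ \delta\big((c,A,b),(\hat c,\hat A,\hat b)\big)\quad\text{s.t.}\quad x\in\operatorname*{arg\,min}_{z:\,Az\ge b,\ z\ge 0} c^\top z,\quad x\in\mathcal{D}(\hat x),\quad (c,A,b)\in\mathcal{H}$$ is equivalent to the problem $$(\mathrm{WCEP'}):\quad \inf_{x,y,c,A,b}\ \delta\big((c,A,b),(\hat c,\hat A,\hat b)\big)\quad\text{s.t.}\quad c^\top x\le b^\top y,\quad A^\top y\le c,\quad Ax\ge b,\quad x\in\mathcal{D}(\hat x),\quad (c,A,b)\in\mathcal{H},\quad x\ge 0,\ y\ge 0,$$ where $x\in\mathbb{R}^n$, $y\in\mathbb{R}^m$. That is, a point $(x,c,A,b)$ is feasible for (WCEP) if and only if there exists $y$ such that $(x,y,c,A,b)$ is feasible for (WCEP'); the two problems have the same objective function and hence the same optimal value.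
   Context: Setting: the present problem is the linear program $\min\{\hat c^\top x:\ \hat A x\ge \hat b,\ x\ge 0\}$ with $\hat c\in\mathbb{R}^n$, $\hat A\in\mathbb{R}^{m\times n}$, $\hat b\in\mathbb{R}^m$, assumed feasible, with optimal solution $\hat x$. The set $\mathcal{H}$ (mutable parameter space) is the set of admissible parameter triples $(c,A,b)$; the set $\mathcal{D}(\hat x)$ is the favored solution space. The set $\arg\min_{z:Az\ge b,z\ge0}c^\top z$ is the set of optimal solutions of the linear program with parameters $(c,A,b)$ (empty if that program is infeasible or unbounded). All vector inequalities are componentwise; the infimum over an empty set is $+\infty$. *)

theory Defs
  imports "HOL-Analysis.Analysis"
begin

text \<open>
  A parameter triple \<open>(c, A, b)\<close> of a linear program with \<open>n = CARD('n)\<close> variables and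
  \<open>m = CARD('m)\<close> constraints. The type \<open>real ^ 'n ^ 'm\<close> consists of matrices with rows indexed
  by \<open>'m\<close> and columns indexed by \<open>'n\<close>. The library order \<open>\<le>\<close> on vectors is componentwise.
\<close>

type_synonym ('n, 'm) lp_params = "(real ^ 'n) \<times> (real ^ 'n ^ 'm) \<times> (real ^ 'm)"

definition lp_feasible :: "real ^ 'n ^ 'm \<Rightarrow> real ^ 'm \<Rightarrow> (real ^ 'n) set" where
  "lp_feasible A b = {z. A *v z \<ge> b \<and> z \<ge> 0}"

definition lp_argmin :: "real ^ 'n \<Rightarrow> real ^ 'n ^ 'm \<Rightarrow> real ^ 'm \<Rightarrow> (real ^ 'n) set" where
  "lp_argmin c A b = {x. is_arg_min (\<lambda>z. c \<bullet> z) (\<lambda>z. z \<in> lp_feasible A b) x}"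

text \<open>In the problems below, \<open>D\<close> is the favored solution space of the present optimal solution.\<close>

definition wcep_feasible ::
  "('n, 'm::finite) lp_params set \<Rightarrow> (real ^ 'n) set
    \<Rightarrow> ((real ^ 'n) \<times> ('n, 'm) lp_params) set" where
  "wcep_feasible H D = {(x, c, A, b). x \<in> lp_argmin c A b \<and> x \<in> D \<and> (c, A, b) \<in> H}"

definition wcep_objective ::
  "(('n, 'm::finite) lp_params \<times> ('n, 'm) lp_params \<Rightarrow> real) \<Rightarrow> ('n, 'm) lp_params
    \<Rightarrow> (real ^ 'n) \<times> ('n, 'm) lp_params \<Rightarrow> real" where
  "wcep_objective \<delta> p0 = (\<lambda>(x, c, A, b). \<delta> ((c, A, b), p0))"

definition wcep'_feasible ::
  "('n, 'm) lp_params set \<Rightarrow> (real ^ 'n) set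
    \<Rightarrow> ((real ^ 'n) \<times> (real ^ 'm) \<times> ('n, 'm) lp_params) set" where
  "wcep'_feasible H D = {(x, y, c, A, b).
     c \<bullet> x \<le> b \<bullet> y \<and> transpose A *v y \<le> c \<and> A *v x \<ge> b \<and>
     x \<in> D \<and> (c, A, b) \<in> H \<and> x \<ge> 0 \<and> y \<ge> 0}"

definition wcep'_objective ::
  "(('n, 'm) lp_params \<times> ('n, 'm) lp_params \<Rightarrow> real) \<Rightarrow> ('n, 'm) lp_params
    \<Rightarrow> (real ^ 'n) \<times> (real ^ 'm) \<times> ('n, 'm) lp_params \<Rightarrow> real" where
  "wcep'_objective \<delta> p0 = (\<lambda>(x, y, c, A, b). \<delta> ((c, A, b), p0))"

text \<open>The infimum is taken in the extended reals, so that it is \<open>\<infinity>\<close> over an empty feasible set.\<close>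

definition optimal_value :: "('a \<Rightarrow> real) \<Rightarrow> 'a set \<Rightarrow> ereal" where
  "optimal_value f F = (INF p\<in>F. ereal (f p))"

end

theory Submission
  imports Defs
begin

text \<open>
  Weak duality gives one direction. For the other, a dual certificate for an optimal \<open>x\<close> exists iff
  \<open>(c, c \<bullet> x)\<close> lies in the finitely generated, hence closed, cone of all \<open>(p, r)\<close> with
  \<open>transpose A *v y \<le> p\<close> and \<open>r \<le> b \<bullet> y\<close> for some \<open>y \<ge> 0\<close>. Otherwise a hyperplane with normal
  \<open>(u, -\<sigma>)\<close> separates it from the cone, and \<open>u / \<sigma>\<close> (if \<open>\<sigma> > 0\<close>) or \<open>x + u\<close> (if \<open>\<sigma> = 0\<close>) is
  feasible with a smaller cost than \<open>x\<close>.
\<close>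

lemma inner_nonneg_vec:
  fixes x y :: "real ^ 'n"
  assumes "0 \<le> x" "0 \<le> y"
  shows "0 \<le> x \<bullet> y"
  using assms by (auto simp: inner_vec_def less_eq_vec_def intro!: sum_nonneg)

lemma inner_right_mono_vec:
  fixes x y z :: "real ^ 'n"
  assumes "0 \<le> x" "y \<le> z"
  shows "x \<bullet> y \<le> x \<bullet> z"
  using inner_nonneg_vec[of x "z - y"] assms by (simp add: inner_diff_right)

lemma inner_transpose_mult:
  fixes A :: "real ^ 'n ^ 'm"
  shows "(transpose A *v y) \<bullet> z = y \<bullet> (A *v z)"
  by (simp add: dot_lmul_matrix)

lemma lp_argmin_iff:
  "x \<in> lp_argmin c A b \<longleftrightarrow>
     x \<in> lp_feasible A b \<and> (\<forall>z \<in> lp_feasible A b. c \<bullet> x \<le> c \<bullet> z)"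
  by (auto simp: lp_argmin_def is_arg_min_linorder)

text \<open>Both sides are compared with \<open>y \<bullet> (A *v z)\<close>:
  \<open>y \<ge> 0\<close> is paired with \<open>b \<le> A *v z\<close>, and
  \<open>z \<ge> 0\<close> with the dual constraint.\<close>

lemma lp_weak_duality:
  assumes "z \<in> lp_feasible A b" "0 \<le> y" "transpose A *v y \<le> c"
  shows "b \<bullet> y \<le> c \<bullet> z"
proof -
  have "b \<bullet> y \<le> y \<bullet> (A *v z)"
    using inner_right_mono_vec[of y b "A *v z"] assms by (simp add: lp_feasible_def inner_commute)
  also have "\<dots> = z \<bullet> (transpose A *v y)"
    by (metis inner_transpose_mult inner_commute)
  also have "\<dots> \<le> c \<bullet> z"
    using inner_right_mono_vec[of z "transpose A *v y" c] assms
    by (simp add: lp_feasible_def inner_commute[of c] del: transpose_matrix_vector)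
  finally show ?thesis .
qed

text \<open>A finitely generated cone is polyhedral, hence closed, so a hyperplane strictly
  separates \<open>v\<close> from it. Since 0 lies in the cone, the threshold is negative; closure
  under scaling then rules out a negative product with any generator.\<close>

lemma farkas_convex_cone_hull:
  fixes S :: "'a::euclidean_space set"
  assumes "finite S" "v \<notin> convex_cone hull S"
  obtains a where "a \<bullet> v < 0" "\<And>s. s \<in> S \<Longrightarrow> 0 \<le> a \<bullet> s"
proof -
  let ?K = "convex_cone hull S"
  have "closed ?K"
    using assms(1) by (intro polyhedron_imp_closed polyhedron_convex_cone_hull)
  then obtain a \<beta> where a: "a \<bullet> v < \<beta>" "\<forall>w\<in>?K. \<beta> < a \<bullet> w"
    using separating_hyperplane_closed_point convex_convex_cone_hull assms(2) by metis
  have "\<beta> < 0"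
    using a(2) convex_cone_hull_contains_0[of S] by force
  have "0 \<le> a \<bullet> s" if "s \<in> S" for s
  proof (rule ccontr)
    assume neg: "\<not> 0 \<le> a \<bullet> s"
    \<comment> \<open>The factor is positive and makes the product with \<open>a\<close> exactly
      \<open>\<beta>\<close>, against the strict bound on the cone.\<close>
    have "(\<beta> / (a \<bullet> s)) *\<^sub>R s \<in> ?K"
      using neg \<open>\<beta> < 0\<close> that by (intro convex_cone_hull_mul hull_inc divide_nonpos_neg) auto
    then show False
      using a(2) neg by force
  qed
  then show ?thesis
    using that a(1) \<open>\<beta> < 0\<close> by force
qed

text \<open>Farkas alternative for the dual constraints together with the level
  \<open>\<gamma>\<close>; \<open>\<sigma>\<close> is the multiplier of
  \<open>\<gamma> \<le> b \<bullet> y\<close>. Strong duality applies it with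
  \<open>\<gamma> = c \<bullet> x\<close>.\<close>

lemma lp_farkas:
  fixes A :: "real ^ 'n ^ 'm" and b :: "real ^ 'm" and c :: "real ^ 'n"
  assumes none: "\<not> (\<exists>y\<ge>0. transpose A *v y \<le> c \<and> \<gamma> \<le> b \<bullet> y)"
  obtains u \<sigma> where "0 \<le> u" "0 \<le> \<sigma>" "\<sigma> *\<^sub>R b \<le> A *v u" "c \<bullet> u < \<sigma> * \<gamma>"
proof -
  define K where "K = {(p, r). \<exists>y\<ge>0. transpose A *v y \<le> p \<and> r \<le> b \<bullet> y}"
  \<comment> \<open>The first generators come from the unit vectors \<open>y\<close>; the others are
    slack, upwards in \<open>p\<close> and downwards in \<open>r\<close>. The inclusion of the hull
    of \<open>S\<close> in \<open>K\<close> carries \<open>(c, \<gamma>) \<notin> K\<close> over to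
    the hull.\<close>
  define S where "S = range (\<lambda>i. (row i A, b $ i)) \<union> range (\<lambda>j. (axis j 1, 0)) \<union> {(0, -1)}"
  have axis_nonneg: "0 \<le> axis k (1::real)" for k :: "'k::finite"
    by (simp add: less_eq_vec_def axis_def)
  have "S \<subseteq> K"
  proof -
    have "(row i A, b $ i) \<in> K" for i
      unfolding K_def using axis_nonneg
      by (auto intro!: exI[of _ "axis i 1"] simp del: transpose_matrix_vector
          simp: matrix_vector_mult_basis inner_axis)
    moreover have "(axis j 1, 0) \<in> K" "(0, -1) \<in> K" for j
      unfolding K_def using axis_nonneg by (auto intro!: exI[of _ 0])
    ultimately show ?thesis
      by (auto simp: S_def)
  qed
  moreover have "convex_cone K"
    unfolding convex_cone_iff
  proof (intro conjI ballI allI impI)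
    show "0 \<in> K"
      by (auto simp: K_def zero_prod_def intro!: exI[of _ 0])
  next
    fix v w assume "v \<in> K" "w \<in> K"
    then obtain y y' where "0 \<le> y" "transpose A *v y \<le> fst v" "snd v \<le> b \<bullet> y"
      and "0 \<le> y'" "transpose A *v y' \<le> fst w" "snd w \<le> b \<bullet> y'"
      by (auto simp: K_def)
    then have "0 \<le> y + y' \<and> transpose A *v (y + y') \<le> fst (v + w) \<and> snd (v + w) \<le> b \<bullet> (y + y')"
      by (auto simp del: transpose_matrix_vector
          simp: matrix_vector_right_distrib inner_add_right intro: add_mono)
    then show "v + w \<in> K"
      by (auto simp: K_def case_prod_beta)
  next
    fix v and t :: real assume "v \<in> K" "0 \<le> t"
    then obtain y where "0 \<le> y" "transpose A *v y \<le> fst v" "snd v \<le> b \<bullet> y"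
      by (auto simp: K_def)
    then have "0 \<le> t *\<^sub>R y \<and> transpose A *v (t *\<^sub>R y) \<le> fst (t *\<^sub>R v)
        \<and> snd (t *\<^sub>R v) \<le> b \<bullet> (t *\<^sub>R y)"
      using \<open>0 \<le> t\<close>
      by (auto simp del: transpose_matrix_vector
          simp: matrix_vector_mult_scaleR
          intro: scaleR_left_mono mult_left_mono scaleR_nonneg_nonneg)
    then show "t *\<^sub>R v \<in> K"
      by (auto simp: K_def case_prod_beta)
  qed
  ultimately have "convex_cone hull S \<subseteq> K"
    by (rule hull_minimal)
  then have "(c, \<gamma>) \<notin> convex_cone hull S"
    using none by (auto simp: K_def)
  moreover have "finite S"
    by (simp add: S_def)
  ultimately obtain a where a: "a \<bullet> (c, \<gamma>) < 0" "\<And>s. s \<in> S \<Longrightarrow> 0 \<le> a \<bullet> s"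
    using farkas_convex_cone_hull by blast
  obtain u \<tau> where a_eq: "a = (u, \<tau>)"
    by (cases a)
  show ?thesis
  \<comment> \<open>Each kind of generator gives one condition: the axis vectors the sign of
    \<open>u\<close>, \<open>(0, -1)\<close> the sign of \<open>\<tau>\<close>, the rows the bound
    on \<open>A *v u\<close>. The strict inequality is the separation of
    \<open>(c, \<gamma>)\<close>.\<close>
  proof (rule that[of u "- \<tau>"])
    show "0 \<le> u"
      using a(2)[of "(axis _ 1, 0)"] by (simp add: S_def a_eq less_eq_vec_def inner_axis)
    show "0 \<le> - \<tau>"
      using a(2)[of "(0, -1)"] by (simp add: S_def a_eq)
    have "- (\<tau> * b $ i) \<le> u \<bullet> row i A" for i
      using a(2)[of "(row i A, b $ i)"] by (simp add: S_def a_eq)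
    then show "(- \<tau>) *\<^sub>R b \<le> A *v u"
      by (simp add: less_eq_vec_def matrix_vector_mul_component row_def inner_commute
          vec_lambda_eta)
    show "c \<bullet> u < - \<tau> * \<gamma>"
      using a(1) by (simp add: a_eq inner_commute mult.commute)
  qed
qed

lemma lp_strong_duality:
  fixes A :: "real ^ 'n ^ 'm"
  assumes "x \<in> lp_argmin c A b"
  obtains y where "0 \<le> y" "transpose A *v y \<le> c" "c \<bullet> x \<le> b \<bullet> y"
proof (rule ccontr)
  assume "\<not> thesis"
  with that have "\<not> (\<exists>y\<ge>0. transpose A *v y \<le> c \<and> c \<bullet> x \<le> b \<bullet> y)"
    by blast
  then obtain u \<sigma> where u: "0 \<le> u" "0 \<le> \<sigma>" "\<sigma> *\<^sub>R b \<le> A *v u" "c \<bullet> u < \<sigma> * (c \<bullet> x)"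
    by (rule lp_farkas)
  have x: "b \<le> A *v x" "0 \<le> x" and opt: "\<And>z. z \<in> lp_feasible A b \<Longrightarrow> c \<bullet> x \<le> c \<bullet> z"
    using assms by (auto simp: lp_argmin_iff lp_feasible_def)
  show False
  proof (cases "\<sigma> = 0")
    case True
    \<comment> \<open>Here \<open>u\<close> is a recession direction of the feasible set along which
      the cost strictly decreases.\<close>
    then have "x + u \<in> lp_feasible A b"
      using u x add_mono[of b "A *v x" 0 "A *v u"]
      by (simp add: lp_feasible_def matrix_vector_right_distrib)
    from opt[OF this] show False
      using u(4) True by (simp add: inner_add_right)
  next
    case False
    then have "0 < \<sigma>"
      using u(2) by simp
    \<comment> \<open>Dividing by \<open>\<sigma>\<close> restores the right-hand side
      \<open>b\<close> and brings the cost below \<open>c \<bullet> x\<close>.\<close>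
    have "inverse \<sigma> *\<^sub>R u \<in> lp_feasible A b"
      using scaleR_left_mono[OF u(3), of "inverse \<sigma>"] u(1) \<open>0 < \<sigma>\<close>
      by (simp add: lp_feasible_def matrix_vector_mult_scaleR scaleR_nonneg_nonneg)
    from opt[OF this] show False
      using u(4) \<open>0 < \<sigma>\<close> by (simp add: field_simps)
  qed
qed

text \<open>Strong duality supplies \<open>y\<close>. Conversely, weak duality bounds the cost of
  every feasible point below by \<open>b \<bullet> y\<close>, hence by
  \<open>c \<bullet> x\<close>.\<close>

lemma lp_argmin_iff_dual_certificate:
  fixes A :: "real ^ 'n ^ 'm"
  shows "x \<in> lp_argmin c A b \<longleftrightarrow>
    (\<exists>y\<ge>0. c \<bullet> x \<le> b \<bullet> y \<and> transpose A *v y \<le> c \<and> b \<le> A *v x \<and> 0 \<le> x)"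
proof
  assume "x \<in> lp_argmin c A b"
  moreover from this obtain y where "0 \<le> y" "transpose A *v y \<le> c" "c \<bullet> x \<le> b \<bullet> y"
    by (rule lp_strong_duality)
  ultimately show "\<exists>y\<ge>0. c \<bullet> x \<le> b \<bullet> y \<and> transpose A *v y \<le> c \<and> b \<le> A *v x \<and> 0 \<le> x"
    unfolding lp_argmin_iff lp_feasible_def by blast
next
  assume "\<exists>y\<ge>0. c \<bullet> x \<le> b \<bullet> y \<and> transpose A *v y \<le> c \<and> b \<le> A *v x \<and> 0 \<le> x"
  then obtain y where y: "0 \<le> y" "c \<bullet> x \<le> b \<bullet> y" "transpose A *v y \<le> c"
    and x: "b \<le> A *v x" "0 \<le> x"
    by blast
  have "c \<bullet> x \<le> c \<bullet> z" if "z \<in> lp_feasible A b" for z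
    using y(2) lp_weak_duality[OF that y(1,3)] by (rule order_trans)
  with x show "x \<in> lp_argmin c A b"
    by (simp add: lp_argmin_iff lp_feasible_def)
qed

theorem theorem3p1:
  fixes c_hat :: "real ^ 'n" and A_hat :: "real ^ 'n ^ 'm" and b_hat :: "real ^ 'm"
    and x_hat :: "real ^ 'n"
    and H :: "('n, 'm) lp_params set"
    and D :: "real ^ 'n \<Rightarrow> (real ^ 'n) set"
    and \<delta> :: "('n, 'm) lp_params \<times> ('n, 'm) lp_params \<Rightarrow> real"
  assumes x_hat_optimal: "x_hat \<in> lp_argmin c_hat A_hat b_hat"
    and params_in_H: "(c_hat, A_hat, b_hat) \<in> H"
    and delta_nonneg: "\<delta> \<in> H \<times> H \<rightarrow> {0..}"
  shows "(\<forall>x c A b. (x, c, A, b) \<in> wcep_feasible H (D x_hat) \<longleftrightarrow>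
            (\<exists>y. (x, y, c, A, b) \<in> wcep'_feasible H (D x_hat)))
       \<and> (\<forall>x y c A b. wcep'_objective \<delta> (c_hat, A_hat, b_hat) (x, y, c, A, b) =
            wcep_objective \<delta> (c_hat, A_hat, b_hat) (x, c, A, b))
       \<and> optimal_value (wcep_objective \<delta> (c_hat, A_hat, b_hat)) (wcep_feasible H (D x_hat)) =
          optimal_value (wcep'_objective \<delta> (c_hat, A_hat, b_hat)) (wcep'_feasible H (D x_hat))"
proof -
  let ?p = "(c_hat, A_hat, b_hat)"
  let ?F = "wcep_feasible H (D x_hat)" and ?F' = "wcep'_feasible H (D x_hat)"
  have feasible_iff: "(x, c, A, b) \<in> ?F \<longleftrightarrow> (\<exists>y. (x, y, c, A, b) \<in> ?F')" for x c A b
    unfolding wcep_feasible_def wcep'_feasible_def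
    by (auto simp: lp_argmin_iff_dual_certificate simp del: transpose_matrix_vector)
  have objective_eq:
    "wcep'_objective \<delta> ?p (x, y, c, A, b) = wcep_objective \<delta> ?p (x, c, A, b)" for x y c A b
    by (simp add: wcep_objective_def wcep'_objective_def)
  \<comment> \<open>Forgetting \<open>y\<close> projects one feasible set onto the other and
    preserves the objective, so both infima range over the same values, also when the sets are
    empty.\<close>
  have "?F = (\<lambda>(x, y, q). (x, q)) ` ?F'"
  proof (intro set_eqI)
    fix w :: "(real ^ 'n) \<times> ('n, 'm) lp_params"
    obtain x c A b where "w = (x, c, A, b)"
      by (cases w)
    then show "w \<in> ?F \<longleftrightarrow> w \<in> (\<lambda>(x, y, q). (x, q)) ` ?F'"
      using feasible_iff[of x c A b] by (fastforce simp: image_iff split: prod.splits)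
  qed
  moreover have "wcep_objective \<delta> ?p ((\<lambda>(x, y, q). (x, q)) w) = wcep'_objective \<delta> ?p w" for w
    by (auto simp: wcep_objective_def wcep'_objective_def split: prod.splits)
  ultimately have "optimal_value (wcep_objective \<delta> ?p) ?F = optimal_value (wcep'_objective \<delta> ?p) ?F'"
    by (simp add: optimal_value_def image_image)
  with feasible_iff objective_eq show ?thesis
    by blast
qed

end
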